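(* Let $n\ge 2$ and let $F=q\circ A\circ\ell$, where $A\in\mathbb{R}^{(n+1)\times(n+1)}$ is a semisimple invertible matrix which is similar to $\varepsilon A^{-1}$ for some $\varepsilon\in\{1,-1\}$. If $X_0\in\mathbb{R}^n\setminus\mathcal{PF}$ is not contained in any proper $F$-invariant affine variety of $\mathbb{R}^n$, then there exists at least one non-degenerate $F$-invariant quadric which contains the whole orbit of $X_0$.
   Context: Define $q(a_1,\dots,a_{n+1})=(a_1/a_{n+1},\dots,a_n/a_{n+1})$ for $(a_1,\dots,a_{n+1})\in\mathbb{R}^{n+1}$ with $a_{n+1}\neq 0$, and $\ell:\mathbb{R}^n\to\mathbb{R}^{n+1}$, $\ell(a_1,\dots,a_n)=(a_1,\dots,a_n,1)^T$. Let $\mathrm{pr}:\mathbb{R}^{n+1}\to\mathbb{R}$ be the projection on the last, $(n+1)$-th, component. For $A\in\mathbb{R}^{(n+1)\times(n+1)}$, the map $F=q\circ A\circ\ell$, $F(X)=q(A\ell(X))$, is defined on $\mathbb{R}^n\setminus\mathcal{PF}$, where $\mathcal{PF}=\{X\in\mathbb{R}^n : \mathrm{pr}(A\ell(X))=0\}$. The orbit of $X_0$ is the sequence of iterates $F^k(X_0)$, $k\ge 0$ (with $F^0(X_0)=X_0$), as far as they are defined. A subset $\mathcal{S}\subset\mathbb{R}^n$ is $F$-invariant if $F(\mathcal{S}\setminus\mathcal{PF})\subset\mathcal{S}$. An affine variety means an affine subspace of $\mathbb{R}^n$ (points, i.e. dimension $0$, are allowed); it is proper if it is different from $\mathbb{R}^n$.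 For a symmetric matrix $M\in\mathbb{R}^{(n+1)\times(n+1)}$, the quadric defined by $M$ is $\mathcal{Q}(M)=\{X\in\mathbb{R}^n : \ell(X)^TM\ell(X)=0\}$; it is non-degenerate if $M$ is invertible. A real matrix is semisimple if it is diagonalizable as a complex matrix. *)

theory Defs
  imports "HOL-Analysis.Analysis"
begin

text \<open>
  Coordinates of \<open>\<real>\<^sup>n\<close> are indexed by a finite type \<open>'n\<close> with \<open>n = CARD('n)\<close>, those of
  \<open>\<real>\<^sup>n\<^sup>+\<^sup>1\<close> by \<open>'n option\<close>: the index \<open>Some i\<close> is the coordinate \<open>i\<close> of \<open>\<real>\<^sup>n\<close>, and \<open>None\<close> is
  the additional, last coordinate.
\<close>

definition lift :: "real ^ 'n \<Rightarrow> real ^ 'n option" where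
  "lift X = (\<chi> i. case i of None \<Rightarrow> 1 | Some j \<Rightarrow> X $ j)"

definition last_coord :: "real ^ ('n::finite) option \<Rightarrow> real" where
  "last_coord Y = Y $ None"

text \<open>Only meaningful if \<open>last_coord Y \<noteq> 0\<close>; otherwise \<open>x / 0 = 0\<close> yields a dummy value.\<close>

definition dehomogenize :: "real ^ 'n option \<Rightarrow> real ^ 'n" where
  "dehomogenize Y = (\<chi> j. Y $ Some j / last_coord Y)"

text \<open>
  The map \<open>F = q \<circ> A \<circ> \<ell>\<close> is partial, with domain \<open>- forbidden A\<close>. Its dummy values on
  \<open>forbidden A\<close> are never used by \<open>proj_invariant\<close> and \<open>orbit\<close> below.
\<close>

definition proj_map :: "real ^ 'n option ^ 'n option \<Rightarrow> real ^ 'n \<Rightarrow> real ^ 'n" where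
  "proj_map A X = dehomogenize (A *v lift X)"

definition forbidden :: "real ^ 'n option ^ 'n option \<Rightarrow> (real ^ 'n) set" where
  "forbidden A = {X. last_coord (A *v lift X) = 0}"

definition proj_invariant :: "real ^ 'n option ^ 'n option \<Rightarrow> (real ^ 'n) set \<Rightarrow> bool" where
  "proj_invariant A S \<longleftrightarrow> proj_map A ` (S - forbidden A) \<subseteq> S"

text \<open>The \<open>k\<close>-th iterate is defined iff no earlier iterate lies in \<open>forbidden A\<close>.\<close>

definition orbit :: "real ^ 'n option ^ 'n option \<Rightarrow> real ^ 'n \<Rightarrow> (real ^ 'n) set" where
  "orbit A X = {(proj_map A ^^ k) X | k. \<forall>j<k. (proj_map A ^^ j) X \<notin> forbidden A}"

definition quadric :: "real ^ 'n option ^ 'n option \<Rightarrow> (real ^ 'n) set" where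
  "quadric M = {X. lift X \<bullet> (M *v lift X) = 0}"

definition similar :: "'a::field ^ 'n ^ 'n \<Rightarrow> 'a ^ 'n ^ 'n \<Rightarrow> bool" where
  "similar A B \<longleftrightarrow> (\<exists>P. invertible P \<and> A = P ** B ** matrix_inv P)"

definition diagonal_matrix :: "'a::zero ^ 'n ^ 'n \<Rightarrow> bool" where
  "diagonal_matrix D \<longleftrightarrow> (\<forall>i j. i \<noteq> j \<longrightarrow> D $ i $ j = 0)"

definition semisimple :: "real ^ 'n ^ 'n \<Rightarrow> bool" where
  "semisimple A \<longleftrightarrow>
    (\<exists>D. diagonal_matrix D \<and> similar (map_matrix complex_of_real A) D)"

end

theory Submission
  imports Defs "HOL-Computational_Algebra.Polynomial"
begin

text \<open>
  Let \<open>v = lift X0\<close>. The hypothesis on \<open>X0\<close> says that no left eigenvector of \<open>A\<close>, real or complex,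
  annihilates \<open>v\<close>. Hence the eigenvalues \<open>d\<^sub>i\<close> of \<open>A\<close> are distinct, and the left eigenvectors can be
  normalised to linear forms \<open>c\<^sub>i\<close> with \<open>c\<^sub>i v = 1\<close>. Similarity to \<open>\<epsilon> A\<inverse>\<close> gives an involution \<open>\<sigma>\<close>
  of the indices with \<open>d\<^sub>i d\<^bsub>\<sigma> i\<^esub> = \<epsilon>\<close>. For every \<open>\<sigma>\<close>-invariant weight \<open>b\<close> the symmetric form
  \<open>\<Sum>\<^sub>i b\<^sub>i c\<^sub>i c\<^bsub>\<sigma> i\<^esub>\<close> is multiplied by \<open>\<epsilon>\<close> under \<open>A\<close>; it is non-degenerate iff all \<open>b\<^sub>i \<noteq> 0\<close>, and its
  value at \<open>v\<close> is \<open>\<Sum>\<^sub>i b\<^sub>i\<close>. As \<open>n + 1 \<ge> 3\<close>, \<open>\<sigma>\<close> has at least two orbits, so non-zero weights with sum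
  \<open>0\<close> exist. All conditions on the resulting complex matrix \<open>M\<close> other than invertibility are real
  linear, so they hold for \<open>Re M + s Im M\<close> with \<open>s\<close> real, and the determinant of this matrix is a
  polynomial in \<open>s\<close> that does not vanish at \<open>s = \<i>\<close>.
\<close>

section \<open>Choice of a real parameter and of weights\<close>

lemma exists_invertible_real_combination:
  fixes M :: "complex ^ 'm ^ 'm"
  assumes "invertible M"
  shows "\<exists>s::real. invertible (map_matrix (\<lambda>z. Re z + s * Im z) M)"
proof -
  \<comment> \<open>\<open>p\<close> is the Leibniz expansion of the determinant of Re M + x Im M.
    Its coefficients are taken complex so that it can be evaluated at the imaginary unit, where the
    matrix becomes \<open>M\<close> itself.\<close>
  define p :: "complex poly" where
    "p = (\<Sum>\<pi> | \<pi> permutes UNIV. of_int (sign \<pi>) *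
      (\<Prod>i\<in>UNIV. [:of_real (Re (M $ i $ \<pi> i)), of_real (Im (M $ i $ \<pi> i)):]))"
  have poly_p: "poly p z = det (\<chi> i j. of_real (Re (M $ i $ j)) + z * of_real (Im (M $ i $ j)))" for z
    unfolding p_def det_def by (simp add: poly_sum poly_prod)
  have "poly p \<i> = det M"
    unfolding poly_p by (rule arg_cong[where f = det]) (simp add: vec_eq_iff complex_eq_iff)
  then have "p \<noteq> 0"
    using assms by (auto simp: invertible_det_nz)
  then have "finite {s::real. poly p (of_real s) = 0}"
    using finite_vimageI[OF poly_roots_finite, of p complex_of_real]
    by (simp add: vimage_def inj_of_real)
  then obtain s :: real where s: "poly p (of_real s) \<noteq> 0"
    using infinite_UNIV_char_0[where 'a = real] by (metis (mono_tags, lifting) UNIV_eq_I mem_Collect_eq)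
  have "poly p (of_real s) = of_real (det (map_matrix (\<lambda>z. Re z + s * Im z) M))"
    unfolding poly_p det_def by (simp add: map_matrix_def)
  with s have "invertible (map_matrix (\<lambda>z. Re z + s * Im z) M)"
    by (auto simp: invertible_det_nz)
  then show ?thesis ..
qed

lemma exists_weights:
  fixes \<sigma> :: "'m::finite \<Rightarrow> 'm"
  assumes invol: "\<And>i. \<sigma> (\<sigma> i) = i" and card: "CARD('m) \<ge> 3"
  shows "\<exists>b :: 'm \<Rightarrow> complex. (\<forall>i. b (\<sigma> i) = b i) \<and> (\<forall>i. b i \<noteq> 0) \<and> sum b UNIV = 0"
proof -
  fix i0 :: 'm
  define T where "T = {i0, \<sigma> i0}"
  have T: "card T \<le> 2" "card T > 0" "card (- T) > 0"
    using card card_insert_le_m1[of 2 "{\<sigma> i0}" i0]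
    by (auto simp: T_def card_insert_if Compl_eq_Diff_UNIV card_Diff_subset)
  \<comment> \<open>Each of the two blocks \<open>T\<close> and \<open>- T\<close> gets the size of
    the other one as its weight, with opposite signs, so the total cancels. Both sizes are positive
    because \<open>T\<close>, an orbit of \<open>\<sigma>\<close>, has at most two elements.\<close>
  define b :: "'m \<Rightarrow> complex" where
    "b i = (if i \<in> T then - of_nat (card (- T)) else of_nat (card T))" for i
  have "\<sigma> i \<in> T \<longleftrightarrow> i \<in> T" for i
    unfolding T_def by (metis insert_iff invol singletonD)
  moreover have "sum b UNIV = 0"
  proof -
    have "sum b UNIV = sum b T + sum b (- T)"
      by (metis finite_code sum.subset_diff Compl_eq_Diff_UNIV subset_UNIV add.commute)
    then show ?thesis by (simp add: b_def)
  qed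
  ultimately show ?thesis
    using T by (intro exI[of _ b]) (auto simp: b_def)
qed

section \<open>Diagonal matrices and their eigenvalues\<close>

lemma diagonal_matrix_mult_vector:
  "diagonal_matrix D \<Longrightarrow> (D *v x) $ i = D $ i $ i * x $ i"
  for D :: "'a::comm_ring_1 ^ 'm ^ 'm"
  unfolding matrix_vector_mult_def diagonal_matrix_def
  by simp (subst sum.remove[of _ i], auto intro!: sum.neutral)

lemma diagonal_matrix_mult_left:
  "diagonal_matrix D \<Longrightarrow> (D ** X) $ i $ j = D $ i $ i * X $ i $ j"
  for D :: "'a::comm_ring_1 ^ 'm ^ 'm"
  unfolding matrix_matrix_mult_def diagonal_matrix_def
  by simp (subst sum.remove[of _ i], auto intro!: sum.neutral)

lemma diagonal_matrix_mult_right: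
  "diagonal_matrix D \<Longrightarrow> (X ** D) $ i $ j = X $ i $ j * D $ j $ j"
  for D :: "'a::comm_ring_1 ^ 'm ^ 'm"
  unfolding matrix_matrix_mult_def diagonal_matrix_def
  by simp (subst sum.remove[of _ j], auto intro!: sum.neutral)

lemma diagonal_matrix_transpose: "diagonal_matrix D \<Longrightarrow> transpose D = D"
  by (auto simp: diagonal_matrix_def transpose_def vec_eq_iff) (metis)

text \<open>The injective map \<open>R\<close> carries the eigenvector \<open>w\<close> of
  \<open>B\<close> to an eigenvector of \<open>D\<close>; any non-zero coordinate of
  \<open>R *v w\<close> singles out the diagonal entry.\<close>

lemma eigenvalue_on_diagonal:
  fixes R :: "'a::field ^ 'm ^ 'm"
  assumes "diagonal_matrix D" "invertible R" "R ** B = D ** R"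
    and "B *v w = \<mu> *s w" "w \<noteq> 0"
  shows "\<exists>j. D $ j $ j = \<mu>"
proof -
  obtain R' where "R' ** R = mat 1"
    using assms(2) invertible_def by blast
  then have "R' *v (R *v w) = w"
    by (simp add: matrix_vector_mul_assoc)
  then have "R *v w \<noteq> 0"
    using assms(5) by auto
  then obtain j where j: "(R *v w) $ j \<noteq> 0"
    by (auto simp: vec_eq_iff)
  have "D *v (R *v w) = \<mu> *s (R *v w)"
    using assms(3,4) by (metis matrix_vector_mul_assoc vector_scalar_commute)
  then have "D $ j $ j * (R *v w) $ j = \<mu> * (R *v w) $ j"
    using diagonal_matrix_mult_vector[OF assms(1)] by (metis vector_smult_component)
  with j show ?thesis by auto
qed

section \<open>Symmetric forms scaled by the matrix\<close>

text \<open>In the coordinates y = \<open>C *v x\<close> the matrix \<open>A\<close> acts as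
  \<open>D\<close> and \<open>v\<close> is the all-ones vector \<open>1\<close>. There the form with
  Gram matrix \<open>B\<close> is the sum of b i * y i * y (\<sigma> i), and \<open>M\<close> is its
  pullback along \<open>C\<close>.\<close>

lemma exists_complex_form:
  fixes A C D :: "complex ^ 'm ^ 'm"
  assumes D: "diagonal_matrix D" and "invertible C" and CA: "C ** A = D ** C"
    and Cv: "C *v v = 1" and inj: "inj (\<lambda>i. D $ i $ i)"
    and recip: "\<And>i. \<exists>j. D $ j $ j * D $ i $ i = of_real \<epsilon>" and "\<epsilon> \<noteq> 0"
    and card: "CARD('m) \<ge> 3"
  shows "\<exists>M. transpose M = M \<and> invertible M \<and> transpose A ** M ** A = \<epsilon> *\<^sub>R M \<and>
    (\<Sum>i\<in>UNIV. v $ i * (M *v v) $ i) = 0"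
proof -
  obtain \<sigma> where \<sigma>: "\<And>i. D $ \<sigma> i $ \<sigma> i * D $ i $ i = of_real \<epsilon>"
    using recip by metis
  have nz: "D $ i $ i \<noteq> 0" for i
    using \<sigma>[of i] \<open>\<epsilon> \<noteq> 0\<close> by auto
  \<comment> \<open>The eigenvalues at \<open>\<sigma> (\<sigma> i)\<close> and at \<open>i\<close>
    both have product \<epsilon> with the one at \<open>\<sigma> i\<close>, so they agree, and
    \<open>inj\<close> identifies the indices.\<close>
  have invol: "\<sigma> (\<sigma> i) = i" for i
  proof (rule injD[OF inj])
    show "D $ \<sigma> (\<sigma> i) $ \<sigma> (\<sigma> i) = D $ i $ i"
      using \<sigma>[of i] \<sigma>[of "\<sigma> i"] nz[of "\<sigma> i"] by (metis mult.commute mult_cancel_left)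
  qed
  obtain b :: "'m \<Rightarrow> complex" where b: "\<And>i. b (\<sigma> i) = b i" "\<And>i. b i \<noteq> 0" "sum b UNIV = 0"
    using exists_weights[OF invol card] by blast
  define B :: "complex ^ 'm ^ 'm" where "B = (\<chi> i j. if j = \<sigma> i then b i else 0)"
  define B' :: "complex ^ 'm ^ 'm" where "B' = (\<chi> i j. if j = \<sigma> i then inverse (b i) else 0)"
  have B_sym: "transpose B = B"
    using b(1) invol by (auto simp: B_def transpose_def vec_eq_iff)
  \<comment> \<open>Matrices supported on the graph of an involution have a diagonal product; this
    gives the inverse \<open>B'\<close> of \<open>B\<close>.\<close>
  have mm: "(\<chi> i j. if j = \<sigma> i then f i else 0) ** (\<chi> i j. if j = \<sigma> i then g i else 0) = mat 1"
    if "\<And>i. f i * g (\<sigma> i) = 1" for f g :: "'m \<Rightarrow> complex"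
    using that invol
    by (auto simp: vec_eq_iff matrix_matrix_mult_def mat_def if_distrib[where f = "\<lambda>x. x * _"]
        cong: if_cong)
  have "invertible B"
    unfolding invertible_def B_def
    by (rule exI[of _ B'], unfold B'_def) (auto intro!: mm simp: b)
  have DBD: "D ** B ** D = \<epsilon> *\<^sub>R B"
    using \<sigma> by (auto simp: vec_eq_iff diagonal_matrix_mult_left[OF D]
        diagonal_matrix_mult_right[OF D] B_def scaleR_conv_of_real[where 'a = complex] mult_ac)
  define M where "M = transpose C ** B ** C"
  have "transpose M = M"
    by (simp add: M_def matrix_transpose_mul B_sym matrix_mul_assoc)
  moreover have "invertible M"
    using \<open>invertible C\<close> \<open>invertible B\<close> unfolding M_def
    by (simp add: invertible_det_nz det_mul)
  moreover have "transpose A ** M ** A = \<epsilon> *\<^sub>R M"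
  proof -
    have AC: "transpose A ** transpose C = transpose C ** D"
      using CA by (metis matrix_transpose_mul diagonal_matrix_transpose[OF D])
    have "transpose A ** M ** A = (transpose A ** transpose C) ** B ** (C ** A)"
      by (simp add: M_def matrix_mul_assoc)
    also have "\<dots> = transpose C ** (D ** B ** D) ** C"
      by (simp add: AC CA matrix_mul_assoc)
    also have "\<dots> = \<epsilon> *\<^sub>R M"
      unfolding DBD M_def
      by (simp add: vec_eq_iff matrix_matrix_mult_def scaleR_sum_right sum_distrib_left sum_distrib_right)
    finally show ?thesis .
  qed
  moreover have "(\<Sum>i\<in>UNIV. v $ i * (M *v v) $ i) = 0"
  proof -
    have "(\<Sum>i\<in>UNIV. v $ i * (M *v v) $ i) = (\<Sum>i\<in>UNIV. v $ i * (transpose C *v (B *v (C *v v))) $ i)"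
      by (simp add: M_def matrix_vector_mul_assoc matrix_mul_assoc)
    also have "\<dots> = (\<Sum>j\<in>UNIV. (C *v v) $ j * (B *v (C *v v)) $ j)"
    proof -
      have "(\<Sum>i\<in>UNIV. v $ i * (transpose C *v y) $ i) = (\<Sum>j\<in>UNIV. (C *v v) $ j * y $ j)" for y
        by (simp add: matrix_vector_mult_def vector_matrix_mult_def transpose_def
              sum_distrib_left sum_distrib_right mult_ac)
          (rule sum.swap)
      then show ?thesis .
    qed
    also have "\<dots> = sum b UNIV"
      unfolding Cv by (simp add: matrix_vector_mult_def B_def)
    finally show ?thesis using b by simp
  qed
  ultimately show ?thesis by blast
qed

text \<open>The map z -> Re z + s * Im z is real linear. Applied entrywise it therefore commutes
  with products by real matrices and vectors, and all the equations for \<open>M\<close> pass to its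
  image.\<close>

lemma exists_real_form:
  fixes A :: "real ^ 'm ^ 'm" and M :: "complex ^ 'm ^ 'm" and v :: "real ^ 'm"
  assumes sym: "transpose M = M" and inv: "invertible M"
    and inva: "transpose (map_matrix of_real A) ** M ** map_matrix of_real A = \<epsilon> *\<^sub>R M"
    and null: "(\<Sum>i\<in>UNIV. of_real (v $ i) * (M *v (\<chi> i. of_real (v $ i))) $ i) = 0"
  shows "\<exists>N. transpose N = N \<and> invertible N \<and> transpose A ** N ** A = \<epsilon> *\<^sub>R N \<and>
    v \<bullet> (N *v v) = 0"
proof -
  obtain s where s: "invertible (map_matrix (\<lambda>z. Re z + s * Im z) M)"
    using exists_invertible_real_combination[OF inv] by blast
  define f where "f z = Re z + s * Im z" for z
  have f_sum: "f (sum g I) = (\<Sum>i\<in>I. f (g i))" for g :: "'m \<Rightarrow> complex" and I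
    by (simp add: f_def sum.distrib sum_distrib_left)
  have f_scale: "f (of_real a * z) = a * f z" "f (z * of_real a) = f z * a" "f (a *\<^sub>R z) = a * f z" "f 0 = 0"
    for a z by (simp_all add: f_def algebra_simps)
  define N where "N = map_matrix f M"
  have "transpose N = N"
    using sym by (simp add: N_def vec_eq_iff transpose_def)
  moreover have "invertible N"
    using s by (simp add: N_def f_def[abs_def])
  moreover have "transpose A ** N ** A = \<epsilon> *\<^sub>R N"
  proof -
    have "transpose A ** N ** A = map_matrix f (transpose (map_matrix of_real A) ** M ** map_matrix of_real A)"
      by (simp add: N_def vec_eq_iff matrix_matrix_mult_def transpose_def f_sum f_scale)
    then show ?thesis
      by (simp add: inva N_def vec_eq_iff f_scale)
  qed
  moreover have "v \<bullet> (N *v v) = 0"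
  proof -
    have "v \<bullet> (N *v v) = f (\<Sum>i\<in>UNIV. of_real (v $ i) * (M *v (\<chi> i. of_real (v $ i))) $ i)"
      by (simp add: N_def inner_vec_def matrix_vector_mult_def f_sum f_scale)
    then show ?thesis by (simp add: null f_scale)
  qed
  ultimately show ?thesis by blast
qed

section \<open>Invariant sets of the projective map\<close>

lemma lift_dehomogenize:
  "lift (dehomogenize Y) = inverse (last_coord Y) *\<^sub>R Y" if "last_coord Y \<noteq> 0"
  using that
  by (auto simp: vec_eq_iff lift_def dehomogenize_def last_coord_def field_simps split: option.split)

lemma lift_proj_map:
  "X \<notin> forbidden A \<Longrightarrow> lift (proj_map A X) = inverse (last_coord (A *v lift X)) *\<^sub>R (A *v lift X)"
  by (simp add: forbidden_def proj_map_def lift_dehomogenize)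

text \<open>Up to a scalar, the lift of the image point is \<open>A *v lift X\<close>, where the
  form takes \<epsilon> times its value at \<open>lift X\<close>; the zero set ignores both
  factors.\<close>

lemma proj_invariant_quadric:
  assumes "transpose A ** M ** A = \<epsilon> *\<^sub>R M"
  shows "proj_invariant A (quadric M)"
  unfolding proj_invariant_def
proof safe
  fix X assume X: "X \<in> quadric M" "X \<notin> forbidden A"
  have "(A *v lift X) \<bullet> (M *v (A *v lift X)) = lift X \<bullet> ((transpose A ** M ** A) *v lift X)"
    by (metis dot_lmul_matrix inner_commute matrix_vector_mul_assoc transpose_matrix_vector)
  also have "\<dots> = 0"
    using X by (simp add: assms quadric_def scaleR_matrix_vector_assoc[symmetric])
  finally show "proj_map A X \<in> quadric M"
    using X by (simp add: quadric_def lift_proj_map matrix_vector_mult_scaleR)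
qed

lemma orbit_subset:
  assumes "proj_invariant A S" "X \<in> S"
  shows "orbit A X \<subseteq> S"
proof -
  have "(proj_map A ^^ k) X \<in> S" if "\<forall>j<k. (proj_map A ^^ j) X \<notin> forbidden A" for k
    using that
  proof (induction k)
    case (Suc k)
    then show ?case
      using assms(1) by (auto simp: proj_invariant_def)
  qed (use assms in simp)
  then show ?thesis
    by (auto simp: orbit_def)
qed

text \<open>The kernel of a left eigenvector, intersected with the affine chart, is an invariant affine variety.\<close>

lemma left_eigenvector_nonzero:
  fixes A :: "real ^ ('n::finite) option ^ 'n option" and w :: "complex ^ 'n option"
  assumes cyc: "\<not> (\<exists>S. affine S \<and> S \<noteq> UNIV \<and> proj_invariant A S \<and> X \<in> S)"
    and w: "w v* map_matrix of_real A = \<mu> *s w" "w \<noteq> 0"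
  shows "(\<Sum>i\<in>UNIV. w $ i * of_real (lift X $ i)) \<noteq> 0"
proof
  \<comment> \<open>\<open>g\<close> is complex valued on real vectors, so its vanishing amounts to
    two real linear equations, one for the real and one for the imaginary part.\<close>
  define g where "g Y = (\<Sum>i\<in>UNIV. w $ i * of_real (Y $ i))" for Y :: "real ^ 'n option"
  define S where "S = {X. g (lift X) = 0}"
  have g_add: "g (Y + Z) = g Y + g Z" for Y Z
    by (simp add: g_def algebra_simps sum.distrib)
  have g_scale: "g (a *\<^sub>R Y) = of_real a * g Y" for a Y
    by (simp add: g_def sum_distrib_left mult_ac)
  have g_mult: "g (A *v Y) = \<mu> * g Y" for Y
  proof -
    have "g (A *v Y) = (\<Sum>j\<in>UNIV. (w v* map_matrix of_real A) $ j * of_real (Y $ j))"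
      unfolding g_def
      by (simp add: matrix_vector_mult_def vector_matrix_mult_def sum_distrib_left sum_distrib_right mult_ac)
        (rule sum.swap)
    then show ?thesis
      by (simp add: w g_def sum_distrib_left mult_ac)
  qed
  assume "(\<Sum>i\<in>UNIV. w $ i * of_real (lift X $ i)) = 0"
  then have "X \<in> S"
    by (simp add: S_def g_def)
  moreover have "affine S"
  proof -
    have "lift (a *\<^sub>R x + b *\<^sub>R y) = a *\<^sub>R lift x + b *\<^sub>R lift y" if "a + b = 1" for a b and x y :: "real ^ 'n"
      using that by (auto simp: vec_eq_iff lift_def split: option.split)
    then show ?thesis
      by (simp add: affine_def S_def g_add g_scale)
  qed
  moreover have "proj_invariant A S"
    by (auto simp: proj_invariant_def S_def lift_proj_map g_scale g_mult)
  ultimately have "S = UNIV"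
    using cyc by blast
  then have zero: "g (lift x) = 0" for x
    by (auto simp: S_def)
  \<comment> \<open>The standard basis is recovered from the chart as \<open>lift 0\<close> and the
    differences \<open>lift (axis j 1) - lift 0\<close>, and on it \<open>g\<close> reads off the
    entries of \<open>w\<close>.\<close>
  have "w $ i = 0" for i
  proof -
    have lift0: "lift 0 = (axis None 1 :: real ^ 'n option)"
      by (auto simp: vec_eq_iff lift_def axis_def split: option.split)
    have g_axis: "g (axis i 1) = w $ i" for i
      by (simp add: g_def axis_def if_distrib[where f = "\<lambda>x. _ * of_real x"] cong: if_cong)
    show ?thesis
    proof (cases i)
      case None
      then show ?thesis using zero[of 0] by (simp add: lift0 g_axis)
    next
      case (Some j)
      have "lift (axis j 1) = axis None 1 + (axis (Some j) 1 :: real ^ 'n option)"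
        by (auto simp: vec_eq_iff lift_def axis_def split: option.split)
      then show ?thesis
        using zero[of "axis j 1"] zero[of 0] Some by (simp add: lift0 g_add g_axis)
    qed
  qed
  then show False
    using w(2) by (simp add: vec_eq_iff)
qed

section \<open>Complexification and left eigenvectors\<close>

lemma map_matrix_of_real_mult:
  "map_matrix complex_of_real (X ** Y) = map_matrix of_real X ** map_matrix of_real Y"
  by (simp add: vec_eq_iff matrix_matrix_mult_def)

lemma invertible_map_matrix_of_real:
  "invertible X \<Longrightarrow> invertible (map_matrix complex_of_real X)"
proof -
  have one: "map_matrix complex_of_real (mat 1) = mat 1"
    by (simp add: vec_eq_iff mat_def)
  show "invertible X \<Longrightarrow> invertible (map_matrix complex_of_real X)"
    unfolding invertible_def by (metis map_matrix_of_real_mult one)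
qed

lemma row_vector_matrix_mult: "row i (X ** Y) = row i X v* Y"
  for X Y :: "'a::comm_semiring_1 ^ 'm ^ 'm"
  by (simp add: vec_eq_iff row_def matrix_matrix_mult_def vector_matrix_mult_def mult.commute)

lemma row_nonzero:
  fixes X Y :: "'a::comm_semiring_1 ^ 'm ^ 'm"
  assumes "X ** Y = mat 1"
  shows "row i X \<noteq> 0"
proof
  assume "row i X = 0"
  then have "row i (X ** Y) = 0"
    by (simp add: row_vector_matrix_mult)
  then have "mat 1 $ i $ i = (0 :: 'a)"
    unfolding assms by (simp add: vec_eq_iff row_def)
  then show False
    by (simp add: mat_def)
qed

lemma
  fixes A :: "'a::semiring_1 ^ 'n ^ 'm"
  assumes "invertible A"
  shows matrix_inv_left: "matrix_inv A ** A = mat 1"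
    and matrix_inv_right: "A ** matrix_inv A = mat 1"
  using someI_ex[OF assms[unfolded invertible_def]] by (simp_all add: matrix_inv_def)

text \<open>The rows of the inverse of \<open>P\<close> are left eigenvectors, hence non-zero at
  \<open>v\<close>, and can be divided by their values there.\<close>

lemma normalized_left_eigenbasis:
  fixes A P D :: "complex ^ 'm ^ 'm"
  assumes D: "diagonal_matrix D" and P: "invertible P" and A: "A = P ** D ** matrix_inv P"
    and nonzero: "\<And>w \<mu>. w v* A = \<mu> *s w \<Longrightarrow> w \<noteq> 0 \<Longrightarrow> (\<Sum>i\<in>UNIV. w $ i * v $ i) \<noteq> 0"
  shows "\<exists>C. invertible C \<and> C ** A = D ** C \<and> C *v v = 1 \<and> inj (\<lambda>i. D $ i $ i)"
proof -
  define C0 where "C0 = matrix_inv P"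
  have C0: "C0 ** P = mat 1" "P ** C0 = mat 1"
    using P by (simp_all add: C0_def matrix_inv_left matrix_inv_right)
  have C0_A: "C0 ** A = D ** C0"
    unfolding A C0_def[symmetric] by (metis C0(1) matrix_mul_assoc matrix_mul_lid)
  have "row i C0 \<noteq> 0" for i
    using C0(1) by (rule row_nonzero)
  moreover have eig: "row i X v* A = D $ i $ i *s row i X" if "X ** A = D ** X" for i X
    using that unfolding row_vector_matrix_mult[symmetric]
    by (simp add: vec_eq_iff row_def diagonal_matrix_mult_left[OF D])
  ultimately have x: "(C0 *v v) $ i \<noteq> 0" for i
    using nonzero[OF eig[OF C0_A]] by (simp add: matrix_vector_mult_def row_def)
  define E where "E = (\<chi> i j. if i = j then inverse ((C0 *v v) $ i) else 0)"
  have E: "diagonal_matrix E"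
    by (simp add: E_def diagonal_matrix_def)
  define C where "C = E ** C0"
  have "det E \<noteq> 0"
    using x by (subst det_diagonal) (auto simp: E_def)
  then have "invertible C"
    using C0 unfolding C_def by (metis invertible_det_nz invertible_def det_mul mult_eq_0_iff)
  then obtain C' where C': "C ** C' = mat 1"
    using invertible_def by blast
  have CA: "C ** A = D ** C"
  proof -
    have "E ** D = D ** E"
      using D by (auto simp: vec_eq_iff diagonal_matrix_mult_left[OF D]
          diagonal_matrix_mult_right[OF D] E_def diagonal_matrix_def)
    then show ?thesis
      by (metis C_def C0_A matrix_mul_assoc)
  qed
  have Cv: "C *v v = 1"
    using x by (simp add: C_def matrix_vector_mul_assoc[symmetric] vec_eq_iff
        diagonal_matrix_mult_vector[OF E]) (simp add: E_def)
  have "inj (\<lambda>i. D $ i $ i)"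
  proof (rule injI, rule ccontr)
    fix i j assume eq: "D $ i $ i = D $ j $ j" and "i \<noteq> j"
    \<comment> \<open>With equal eigenvalues the difference satisfies the same eigenvector equation,
      but it vanishes at \<open>v\<close> since both rows take the value 1. So it is zero, and the
      invertible \<open>C\<close> would have two equal rows.\<close>
    let ?w = "row i C - row j C"
    have "?w v* A = D $ i $ i *s ?w"
      using eig[OF CA, of i] eig[OF CA, of j] eq
      by (simp add: vec_eq_iff vector_matrix_mult_def algebra_simps sum_subtractf)
    moreover have "(\<Sum>k\<in>UNIV. ?w $ k * v $ k) = (C *v v) $ i - (C *v v) $ j"
      by (simp add: matrix_vector_mult_def row_def algebra_simps sum_subtractf)
    ultimately have "?w = 0"
      using nonzero[of ?w] Cv by auto
    then have "row i (C ** C') = row j (C ** C')"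
      by (simp add: row_vector_matrix_mult)
    then show False
      using \<open>i \<noteq> j\<close> by (auto simp: C' row_def mat_def vec_eq_iff split: if_splits)
  qed
  with \<open>invertible C\<close> CA Cv show ?thesis by blast
qed

section \<open>Pairing of eigenvalues with product \<epsilon>\<close>

text \<open>Clearing the inverses in the similarity leaves a polynomial identity, which carries over
  entrywise to complex matrices.\<close>

lemma similar_scaled_inverse:
  fixes A :: "real ^ 'm ^ 'm"
  assumes "invertible A" "similar A (\<epsilon> *\<^sub>R matrix_inv A)"
  shows "\<exists>Q. invertible Q \<and> A ** Q ** A = \<epsilon> *\<^sub>R Q"
proof -
  obtain Q where Q: "invertible Q" "A = Q ** (\<epsilon> *\<^sub>R matrix_inv A) ** matrix_inv Q"
    using assms(2) by (auto simp: similar_def)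
  have "A ** Q = Q ** (\<epsilon> *\<^sub>R matrix_inv A)"
    by (metis Q matrix_inv_left matrix_mul_assoc matrix_mul_rid)
  then have "A ** Q ** A = Q ** (\<epsilon> *\<^sub>R matrix_inv A) ** A"
    by simp
  also have "\<dots> = \<epsilon> *\<^sub>R (Q ** (matrix_inv A ** A))"
    by (simp add: matrix_scalar_ac scalar_matrix_assoc[symmetric] matrix_mul_assoc)
  also have "\<dots> = \<epsilon> *\<^sub>R Q"
    by (simp add: assms(1) matrix_inv_left)
  finally show ?thesis using Q by blast
qed

text \<open>If c is row \<open>i\<close> of \<open>C\<close>, with left eigenvalue d, then
  multiplying \<open>AQA\<close> by c shows that cQ is a left eigenvector of \<open>A\<close> with
  eigenvalue \<epsilon> / d.\<close>

lemma eigenvalue_reciprocal: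
  fixes A C D Q :: "complex ^ 'm ^ 'm"
  assumes D: "diagonal_matrix D" and C: "invertible C" and CA: "C ** A = D ** C"
    and Q: "invertible Q" and AQA: "A ** Q ** A = \<epsilon> *\<^sub>R Q" and "\<epsilon> \<noteq> 0"
  shows "\<exists>j. D $ j $ j * D $ i $ i = of_real \<epsilon>"
proof -
  obtain C' where C': "C ** C' = mat 1" "C' ** C = mat 1"
    using C invertible_def by blast
  obtain Q' where Q': "Q ** Q' = mat 1"
    using Q invertible_def by blast
  let ?d = "D $ i $ i"
  define w where "w = row i (C ** Q)"
  have "C ** Q ** (Q' ** C') = mat 1"
    by (metis C'(1) Q' matrix_mul_assoc matrix_mul_rid)
  then have "w \<noteq> 0"
    unfolding w_def by (rule row_nonzero)
  have "row i (C ** (A ** Q ** A)) = row i (D ** (C ** Q ** A))"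
    by (metis CA matrix_mul_assoc)
  also have "\<dots> = ?d *s (w v* A)"
    unfolding w_def row_vector_matrix_mult[symmetric]
    by (simp add: vec_eq_iff row_def diagonal_matrix_mult_left[OF D])
  also have "row i (C ** (A ** Q ** A)) = of_real \<epsilon> *s w"
    unfolding AQA w_def
    by (simp add: vec_eq_iff row_def matrix_matrix_mult_def sum_distrib_left
        scaleR_conv_of_real[where 'a = complex] mult_ac)
  finally have dw: "?d *s (w v* A) = of_real \<epsilon> *s w" ..
  have d: "?d \<noteq> 0"
    using dw \<open>w \<noteq> 0\<close> \<open>\<epsilon> \<noteq> 0\<close> by auto
  have "transpose A *v w = (of_real \<epsilon> / ?d) *s w"
    using dw d by (simp add: vec_eq_iff field_simps)
  \<comment> \<open>Left eigenvectors of \<open>A\<close> are eigenvectors of its transpose, which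
    \<open>transpose C'\<close> diagonalises to the same \<open>D\<close>.\<close>
  moreover have "transpose C' ** transpose A = D ** transpose C'"
  proof -
    have "A ** C' = C' ** D"
      by (metis C' CA matrix_mul_assoc matrix_mul_lid matrix_mul_rid)
    then show ?thesis
      by (metis matrix_transpose_mul diagonal_matrix_transpose[OF D])
  qed
  moreover have "invertible (transpose C')"
    using C' by (metis invertible_def invertible_det_nz det_transpose)
  ultimately obtain j where "D $ j $ j = of_real \<epsilon> / ?d"
    using eigenvalue_on_diagonal[OF D] \<open>w \<noteq> 0\<close> by blast
  with d have "D $ j $ j * ?d = of_real \<epsilon>"
    by simp
  then show ?thesis ..
qed

theorem theorem13:
  fixes A :: "real ^ ('n::finite) option ^ 'n option"
    and X0 :: "real ^ 'n"
    and \<epsilon> :: real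
  assumes "CARD('n) \<ge> 2"
    and "semisimple A"
    and "invertible A"
    and "\<epsilon> \<in> {1, -1}"
    and "similar A (\<epsilon> *\<^sub>R matrix_inv A)"
    and "X0 \<notin> forbidden A"
    and "\<not> (\<exists>S. affine S \<and> S \<noteq> UNIV \<and> proj_invariant A S \<and> X0 \<in> S)"
  shows "\<exists>M. transpose M = M \<and> invertible M \<and>
           proj_invariant A (quadric M) \<and> orbit A X0 \<subseteq> quadric M"
proof -
  let ?A = "map_matrix complex_of_real A"
  let ?v = "(\<chi> i. complex_of_real (lift X0 $ i))"
  have \<epsilon>: "\<epsilon> \<noteq> 0"
    using assms(4) by auto
  obtain D P :: "complex ^ 'n option ^ 'n option"
    where D: "diagonal_matrix D" and P: "invertible P" "?A = P ** D ** matrix_inv P"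
    using assms(2) by (auto simp: semisimple_def similar_def)
  \<comment> \<open>The assumption on invariant affine varieties enters here, as the non-vanishing
    of complex left eigenvectors at the lifted point.\<close>
  obtain C where C: "invertible C" "C ** ?A = D ** C" "C *v ?v = 1" and inj: "inj (\<lambda>i. D $ i $ i)"
    using normalized_left_eigenbasis[OF D P, of ?v] left_eigenvector_nonzero[OF assms(7)] by auto
  obtain Q where Q: "invertible Q" "A ** Q ** A = \<epsilon> *\<^sub>R Q"
    using similar_scaled_inverse[OF assms(3,5)] by blast
  have "?A ** map_matrix of_real Q ** ?A = \<epsilon> *\<^sub>R map_matrix of_real Q"
    unfolding map_matrix_of_real_mult[symmetric] Q by (simp add: vec_eq_iff scaleR_conv_of_real[where 'a = complex])
  then have recip: "\<exists>j. D $ j $ j * D $ i $ i = of_real \<epsilon>" for i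
    by (intro eigenvalue_reciprocal[OF D C(1,2) invertible_map_matrix_of_real[OF Q(1)]] \<epsilon>)
  have "CARD('n option) \<ge> 3"
    using assms(1) by simp
  from exists_complex_form[OF D C inj recip \<epsilon> this] obtain M
    where "transpose M = M" "invertible M" "transpose ?A ** M ** ?A = \<epsilon> *\<^sub>R M"
      "(\<Sum>i\<in>UNIV. ?v $ i * (M *v ?v) $ i) = 0"
    by blast
  then obtain N where N: "transpose N = N" "invertible N" "transpose A ** N ** A = \<epsilon> *\<^sub>R N"
    "lift X0 \<bullet> (N *v lift X0) = 0"
    using exists_real_form[of M A \<epsilon> "lift X0"] by auto
  then have "orbit A X0 \<subseteq> quadric N"
    by (intro orbit_subset proj_invariant_quadric) (auto simp: quadric_def)
  with N proj_invariant_quadric show ?thesis by blast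
qed

end
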